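(* Let $K\ge2$ and $T_K=\log K+\log\log K+1$. For $(\mathbf p,u)\in[0,1]^{K+1}$ define, with $\inf\varnothing=1$, $$F_{\mathrm{UH}}(\mathbf p,u)=\inf\left\{\alpha\in(0,1):\ \frac1K\sum_{k=1}^K\left(\frac{\alpha}{T_Kp_k}-\frac1{T_K}\right)_+\ge u\right\},$$ $$F'_{\mathrm{UH}}(\mathbf p,u)=\inf\left\{\alpha\in(0,1):\ \frac1K\sum_{k=1}^K\left(\frac{\alpha}{T_Kp_k}-\frac1{T_K}\right)\ge u\right\},$$ and $F'_{\mathrm H}(\mathbf p)=(T_K+1)H(\mathbf p)$, seen as a randomized p-merging function whose value is not affected by $u$. The dominations among randomized p-merging functions $F_{\mathrm{UH}}\le F'_{\mathrm{UH}}\le F'_{\mathrm H}$ are strict. Moreover, $$F'_{\mathrm{UH}}(\mathbf p,u)=(T_Ku+1)H(\mathbf p),\qquad F_{\mathrm{UH}}(\mathbf p,u)=\bigwedge_{m=1}^K\left(\frac{uKT_K}m+1\right)H(\mathbf p_{(m)}).$$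
   Context: $\bigwedge$ denotes minimum; $x_+=\max(x,0)$; $\alpha/0=\infty$. $H(\mathbf q)=n\left(\sum_{i=1}^n1/q_i\right)^{-1}$ is the harmonic mean of a vector $\mathbf q$ with $n$ components (equal to $0$ if some $q_i=0$); $\mathbf p_{(m)}$ is the vector of the $m$ smallest elements of $\mathbf p$. Fix an atomless probability space (one supporting a random variable uniform on $[0,1]$); $\mathcal U$ is the set of random variables uniform on $[0,1]$, $\mathcal U^K$ the set of random vectors (arbitrary joint distribution) with all $K$ components in $\mathcal U$, and $\mathcal U^K\otimes\mathcal U$ the set of pairs $(\mathbf P,U)\in\mathcal U^K\times\mathcal U$ with $U$ independent of $\mathbf P$. A randomized p-merging function is an increasing (non-decreasing in each component) Borel function $F:[0,1]^{K+1}\to[0,1]$ with $\mathbb P(F(\mathbf P,U)\le\alpha)\le\alpha$ for all $\alpha\in(0,1)$ and all $(\mathbf P,U)\in\mathcal U^K\otimes\mathcal U$. $F$ dominates $G$ if $F\le G$ at every point, and the domination is strict if $F<G$ at at least one point.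
   Formalization: F'_H and the right-hand sides of both formulas are truncated at 1, since they can exceed 1 (e.g. p=(1,…,1), u=1), and the formula for F_UH is stated only for u>0, since at u=0 F_UH is 0 while the right-hand side is the smallest p-value. *)

theory Defs
  imports "HOL-Probability.Probability"
begin

section \<open>Randomized p-merging functions\<close>

text \<open>
  A vector of \<open>K\<close> p-values is an element of \<open>real ^ 'k\<close>, with \<open>K = CARD('k)\<close>. Functions on
  \<open>[0,1]^(K+1)\<close> are curried total functions; only their values on the unit cube matter.
\<close>

definition unit_cube :: "(real ^ 'k) set" where
  "unit_cube = {p. \<forall>k. 0 \<le> p $ k \<and> p $ k \<le> 1}"

definition uniform01 :: "'a measure \<Rightarrow> ('a \<Rightarrow> real) \<Rightarrow> bool" where
  "uniform01 M U \<longleftrightarrow> U \<in> borel_measurable M \<and> distr M borel U = uniform_measure lborel {0..1}"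

definition atomless_prob_space :: "'a measure \<Rightarrow> bool" where
  "atomless_prob_space M \<longleftrightarrow> prob_space M \<and> (\<exists>U. uniform01 M U)"

text \<open>
  Independence is stated through the generated sigma-algebras because \<open>indep_var\<close> requires both
  random variables to take values in the same type.
\<close>

definition pvals_with_uniform :: "'a measure \<Rightarrow> (('a \<Rightarrow> real ^ 'k) \<times> ('a \<Rightarrow> real)) set" where
  "pvals_with_uniform M = {(P, U).
     (\<forall>k. uniform01 M (\<lambda>\<omega>. P \<omega> $ k)) \<and> uniform01 M U \<and>
     prob_space.indep_set M
       (sets (vimage_algebra (space M) P borel)) (sets (vimage_algebra (space M) U borel))}"

text \<open>
  Uniform random variables lie in \<open>[0,1]\<close> only almost surely; the event below is restricted to
  the almost sure event on which \<open>F (P, U)\<close> is evaluated inside the domain of \<open>F\<close>.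
\<close>

definition randomized_p_merging :: "'a measure \<Rightarrow> (real ^ 'k \<Rightarrow> real \<Rightarrow> real) \<Rightarrow> bool" where
  "randomized_p_merging M F \<longleftrightarrow>
     (\<forall>p\<in>unit_cube. \<forall>u\<in>{0..1}. F p u \<in> {0..1}) \<and>
     (\<forall>p\<in>unit_cube. \<forall>q\<in>unit_cube. \<forall>u\<in>{0..1}. \<forall>v\<in>{0..1}.
        (\<forall>k. p $ k \<le> q $ k) \<longrightarrow> u \<le> v \<longrightarrow> F p u \<le> F q v) \<and>
     (\<lambda>(p, u). F p u) \<in> borel_measurable (restrict_space borel (unit_cube \<times> {0..1})) \<and>
     (\<forall>\<alpha>\<in>{0<..<1}. \<forall>(P, U)\<in>pvals_with_uniform M.
        measure M {\<omega>\<in>space M. P \<omega> \<in> unit_cube \<and> U \<omega> \<in> {0..1} \<and> F (P \<omega>) (U \<omega>) \<le> \<alpha>} \<le> \<alpha>)"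

definition dominates :: "(real ^ 'k \<Rightarrow> real \<Rightarrow> real) \<Rightarrow> (real ^ 'k \<Rightarrow> real \<Rightarrow> real) \<Rightarrow> bool" where
  "dominates F G \<longleftrightarrow> (\<forall>p\<in>unit_cube. \<forall>u\<in>{0..1}. F p u \<le> G p u)"

definition strictly_dominates ::
    "(real ^ 'k \<Rightarrow> real \<Rightarrow> real) \<Rightarrow> (real ^ 'k \<Rightarrow> real \<Rightarrow> real) \<Rightarrow> bool" where
  "strictly_dominates F G \<longleftrightarrow>
     dominates F G \<and> (\<exists>p\<in>unit_cube. \<exists>u\<in>{0..1}. F p u < G p u)"


section \<open>Harmonic means\<close>

definition harmonic_mean :: "'i set \<Rightarrow> ('i \<Rightarrow> real) \<Rightarrow> real" where
  "harmonic_mean I q =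
     (if \<exists>i\<in>I. q i = 0 then 0 else real (card I) / (\<Sum>i\<in>I. 1 / q i))"

definition H :: "real ^ 'k \<Rightarrow> real" where
  "H p = harmonic_mean UNIV (\<lambda>k. p $ k)"

text \<open>The components in increasing order, with multiplicity; the smallest one has index 0.\<close>

definition order_stats :: "real ^ 'k \<Rightarrow> real list" where
  "order_stats p = sorted_list_of_multiset (image_mset (\<lambda>k. p $ k) (mset_set UNIV))"

definition H_smallest :: "nat \<Rightarrow> real ^ 'k \<Rightarrow> real" where
  "H_smallest m p = harmonic_mean {..<m} (\<lambda>i. order_stats p ! i)"


section \<open>The merging functions\<close>

definition T :: "nat \<Rightarrow> real" where
  "T K = ln (real K) + ln (ln (real K)) + 1"

definition inf_or_one :: "real set \<Rightarrow> real" where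
  "inf_or_one A = (if A = {} then 1 else Inf A)"

text \<open>
  The quotients are taken in \<^typ>\<open>ereal\<close>, where \<open>\<alpha> / 0 = \<infinity>\<close> for \<open>\<alpha> > 0\<close>; no summand is \<open>-\<infinity>\<close>.
\<close>

definition F_UH :: "real ^ 'k \<Rightarrow> real \<Rightarrow> real" where
  "F_UH p u = inf_or_one {\<alpha> \<in> {0<..<1}.
     ereal (1 / real CARD('k)) *
       (\<Sum>k\<in>UNIV. max (ereal \<alpha> / ereal (T CARD('k) * p $ k) - ereal (1 / T CARD('k))) 0)
     \<ge> ereal u}"

definition F_UH' :: "real ^ 'k \<Rightarrow> real \<Rightarrow> real" where
  "F_UH' p u = inf_or_one {\<alpha> \<in> {0<..<1}.
     ereal (1 / real CARD('k)) *
       (\<Sum>k\<in>UNIV. (ereal \<alpha> / ereal (T CARD('k) * p $ k) - ereal (1 / T CARD('k))))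
     \<ge> ereal u}"

text \<open>
  Merging functions take values in \<open>[0,1]\<close>, whereas \<open>(T K + 1) * H p\<close> may exceed \<open>1\<close>; it is
  therefore truncated at \<open>1\<close>.
\<close>

definition F_H' :: "real ^ 'k \<Rightarrow> real \<Rightarrow> real" where
  "F_H' p u = min ((T CARD('k) + 1) * H p) 1"

text \<open>
  The order-statistics formula for \<^const>\<open>F_UH\<close> is only valid for \<open>u > 0\<close>: at \<open>u = 0\<close> its right-hand
  side is the smallest p-value, while the infimum defining \<^const>\<open>F_UH\<close> is \<open>0\<close>.
\<close>

lemma F_UH_at_zero: "F_UH p 0 = 0"
proof -
  have "{\<alpha> \<in> {0<..<1}. ereal (1 / real CARD('a)) *
       (\<Sum>k\<in>UNIV. max (ereal \<alpha> / ereal (T CARD('a) * p $ k) - ereal (1 / T CARD('a))) 0)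
     \<ge> ereal 0} = {0<..<1}"
    by (auto intro!: ereal_0_le_mult sum_nonneg simp flip: zero_ereal_def)
  then show ?thesis
    by (simp add: F_UH_def inf_or_one_def)
qed

end

theory Submission
  imports Defs
begin

text \<open>
  Capping the calibrator \<open>(1 / (T x) - 1 / T)\<^sub>+\<close> at \<open>K\<close> does not change the event that the average of
  \<open>K\<close> of its values is at least \<open>u \<le> 1\<close>, and the capped function has integral
  \<open>ln (K T + 1) / T \<le> 1\<close> over \<open>[0,1]\<close>. Since \<open>P(U \<le> X) \<le> E X\<close> for every nonnegative \<open>X\<close>
  independent of the uniform variable \<open>U\<close>, this makes \<open>F_UH\<close> a randomized p-merging function; the
  other two inherit the property from being pointwise larger. A sum of positive parts of a
  decreasing sequence is its largest partial sum, and solving each partial-sum inequality for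
  \<open>\<alpha>\<close> gives the formula for \<open>F_UH\<close>.
\<close>

section \<open>The truncated calibrator\<close>

lemma exp_one_ge: "27 / 10 \<le> exp (1::real)"
proof -
  \<comment> \<open>\<open>145 / 128 = 1 + 1/8 + (1/8)^2 / 2\<close> is the quadratic Taylor bound
    at \<open>1 / 8\<close>. Taken directly at 1, that bound gives only
    \<open>5 / 2\<close>.\<close>
  have "27 / 10 \<le> (145 / 128 :: real) ^ 8" by (simp add: power_divide)
  also have "\<dots> \<le> exp (1 / 8) ^ 8"
    using exp_lower_Taylor_quadratic[of "1/8 :: real"]
    by (intro power_mono) (simp_all add: power2_eq_square)
  also have "\<dots> = exp (1::real)" by (simp flip: exp_of_nat_mult)
  finally show ?thesis .
qed

lemma ln_ge_two_thirds: "2 \<le> K \<Longrightarrow> 2 / 3 \<le> ln (real K)"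
  using ln2_ge_two_thirds ln_mono[of 2 "real K"] by linarith

lemma T_pos:
  assumes "2 \<le> K" shows "0 < T K"
proof -
  define L where "L = ln (real K)"
  have L: "2 / 3 \<le> L" using ln_ge_two_thirds[OF assms] by (simp add: L_def)
  \<comment> \<open>\<open>ln (ln K)\<close> is negative at \<open>K = 2\<close>; the tangent bound
    for \<open>ln (1 / L)\<close> keeps it above \<open>- 1 / 2\<close>.\<close>
  have "- ln L = ln (1 / L)" using L by (simp add: ln_div)
  also have "\<dots> \<le> 1 / L - 1" using L by (intro ln_le_minus_one) simp
  also have "\<dots> \<le> 3 / 2 - 1" using L by (simp add: field_simps)
  finally show ?thesis using L by (simp add: T_def L_def)
qed

text \<open>Since \<open>exp (T K) = e K ln K\<close>, exponentiating and dividing by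
  \<open>K\<close> turns the claim into \<open>T K + 1 / K \<le> e ln K\<close>. With
  \<open>L = ln K\<close> and \<open>1 / K \<le> 1 / 2\<close> it remains to bound
  \<open>L + ln L + 3 / 2\<close> by \<open>e L\<close>.\<close>

lemma ln_KT_le_T:
  assumes "2 \<le> K" shows "ln (real K * T K + 1) \<le> T K"
proof -
  define L where "L = ln (real K)"
  have L: "2 / 3 \<le> L" using ln_ge_two_thirds[OF assms] by (simp add: L_def)
  \<comment> \<open>The factor \<open>36 / 25 = (6 / 5)^2\<close> moves the tangent point of
    \<open>ln\<close> to \<open>L = 25 / 36\<close>, close to \<open>ln 2\<close>, where the
    inequality has little slack.\<close>
  have "ln L = ln (36 / 25 * L) + 2 * ln (5 / 6)"
  proof -
    have "ln (36 / 25 * L) = ln (36 / 25) + ln L" using L by (subst ln_mult) auto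
    also have "ln (36 / 25 :: real) = - (2 * ln (5 / 6))"
      using ln_realpow[of "5/6::real" 2] ln_inverse[of "25/36::real"] by (simp add: power_divide)
    finally show ?thesis by simp
  qed
  also have "\<dots> \<le> (36 / 25 * L - 1) + 2 * (5 / 6 - 1)"
    using L ln_le_minus_one[of "36 / 25 * L"] ln_le_minus_one[of "5 / 6 :: real"] by simp
  finally have "L + ln L + 1 + 1 / 2 \<le> 27 / 10 * L" using L by simp
  also have "\<dots> \<le> exp 1 * L" using exp_one_ge L by (intro mult_right_mono) auto
  finally have "T K + 1 / 2 \<le> exp 1 * L" by (simp add: T_def L_def)
  moreover have "1 / real K \<le> 1 / 2" using assms by simp
  ultimately have "T K + 1 / real K \<le> exp 1 * L" by linarith
  then have "real K * (T K + 1 / real K) \<le> real K * (exp 1 * L)"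
    by (intro mult_left_mono) auto
  then have "real K * T K + 1 \<le> real K * (exp 1 * L)" using assms by (simp add: distrib_left)
  also have "real K * (exp 1 * L) = exp (T K)" using assms L by (simp add: T_def exp_add flip: L_def) (simp add: L_def)
  finally have "real K * T K + 1 \<le> exp (T K)" .
  moreover have "0 < real K * T K + 1" using T_pos[OF assms] by (intro add_nonneg_pos) auto
  ultimately have "ln (real K * T K + 1) \<le> ln (exp (T K))" by (subst ln_le_cancel_iff) auto
  then show ?thesis by simp
qed

text \<open>The cutoff \<open>\<alpha> / (K t + 1)\<close> is the point where \<open>\<alpha> / (t x) - 1 / t\<close> equals \<open>K\<close>.\<close>

definition truncated_calibrator :: "real \<Rightarrow> real \<Rightarrow> real \<Rightarrow> real \<Rightarrow> real" where
  "truncated_calibrator K t \<alpha> x =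
     (if x \<le> \<alpha> / (K * t + 1) then K else max (\<alpha> / (t * x) - 1 / t) 0)"

lemma measurable_truncated_calibrator [measurable]:
  "truncated_calibrator K t \<alpha> \<in> borel_measurable borel"
  unfolding truncated_calibrator_def[abs_def] by measurable

lemma truncated_calibrator_nonneg: "0 \<le> K \<Longrightarrow> 0 \<le> truncated_calibrator K t \<alpha> x"
  by (simp add: truncated_calibrator_def)

text \<open>With \<open>a\<close> the cutoff, the cap contributes \<open>K * a\<close> on
  \<open>[0, a]\<close>. The rest, integrated over \<open>[a, \<alpha>]\<close>, is
  \<open>\<alpha> ln (K t + 1) / t - K a\<close>, because \<open>\<alpha> - a = K t a\<close>. The
  two \<open>K * a\<close> cancel, and the logarithmic hypothesis bounds what remains.\<close>

lemma nn_integral_truncated_calibrator: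
  assumes "0 < K" "0 < t" "0 < \<alpha>" and ln: "ln (K * t + 1) \<le> t"
  shows "(\<integral>\<^sup>+x. ennreal (truncated_calibrator K t \<alpha> x) \<partial>uniform_measure lborel {0..1}) \<le> ennreal \<alpha>"
proof -
  define a where "a = \<alpha> / (K * t + 1)"
  have den: "0 < K * t + 1" using assms by (intro add_pos_pos mult_pos_pos) auto
  have a: "0 < a" "a \<le> \<alpha>" "\<alpha> - a = K * t * a"
    using assms den by (auto simp: a_def field_simps)
  have F: "(\<integral>\<^sup>+x. ennreal (\<alpha> / (t * x) - 1 / t) * indicator {a..\<alpha>} x \<partial>lborel)
      = ennreal ((\<alpha> * ln \<alpha> / t - \<alpha> / t) - (\<alpha> * ln a / t - a / t))"
  proof (rule nn_integral_FTC_Icc)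
    fix x assume "x \<in> {a..\<alpha>}"
    then have x: "a \<le> x" "x \<le> \<alpha>" by auto
    show "((\<lambda>x. \<alpha> * ln x / t - x / t) has_real_derivative \<alpha> / (t * x) - 1 / t) (at x)"
      using x a assms by (auto intro!: derivative_eq_intros simp: field_simps)
    show "0 \<le> \<alpha> / (t * x) - 1 / t" using x a(1) assms(2,3) by (simp add: field_simps)
  qed (use a in auto)
  have "(\<integral>\<^sup>+x. ennreal (truncated_calibrator K t \<alpha> x) \<partial>uniform_measure lborel {0..1})
      = (\<integral>\<^sup>+x. ennreal (truncated_calibrator K t \<alpha> x) * indicator {0..1} x \<partial>lborel)"
    by (subst nn_integral_uniform_measure) (auto simp: divide_ennreal_def)
  \<comment> \<open>Only an inequality: the two intervals share the point \<open>a\<close>, and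
    \<open>\<alpha>\<close> may exceed 1.\<close>
  also have "\<dots> \<le> (\<integral>\<^sup>+x. ennreal K * indicator {0..a} x
      + ennreal (\<alpha> / (t * x) - 1 / t) * indicator {a..\<alpha>} x \<partial>lborel)"
  proof (rule nn_integral_mono)
    fix x :: real
    consider "x < 0" | "0 \<le> x" "x \<le> a" | "a < x" "x \<le> \<alpha>" | "\<alpha> < x" by linarith
    then show "ennreal (truncated_calibrator K t \<alpha> x) * indicator {0..1} x
      \<le> ennreal K * indicator {0..a} x + ennreal (\<alpha> / (t * x) - 1 / t) * indicator {a..\<alpha>} x"
    proof cases
      case 3
      then have "0 \<le> \<alpha> / (t * x) - 1 / t" using assms(2,3) a(1) by (simp add: field_simps)
      with 3 show ?thesis using a
        by (auto simp: truncated_calibrator_def a_def[symmetric] indicator_def)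
    next
      case 4
      then have "\<alpha> / (t * x) - 1 / t \<le> 0" using assms(2,3) a(1) by (simp add: field_simps)
      with 4 show ?thesis using a by (auto simp: truncated_calibrator_def a_def[symmetric])
    qed (use a in \<open>auto simp: truncated_calibrator_def a_def[symmetric] indicator_def\<close>)
  qed
  also have "\<dots> = ennreal (K * a) + ennreal ((\<alpha> * ln \<alpha> / t - \<alpha> / t) - (\<alpha> * ln a / t - a / t))"
    using a assms by (subst nn_integral_add) (auto simp: F nn_integral_cmult ennreal_mult')
  also have "(\<alpha> * ln \<alpha> / t - \<alpha> / t) - (\<alpha> * ln a / t - a / t) = \<alpha> * ln (K * t + 1) / t - K * a"
  proof -
    have e: "ln \<alpha> = ln a + ln (K * t + 1)" unfolding a_def using assms den by (simp add: ln_div)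
    have "\<alpha> / t = K * a + a / t"
      using a(3) assms by (simp add: field_simps)
    then show ?thesis unfolding e distrib_left add_divide_distrib by linarith
  qed
  also have "ennreal (K * a) + ennreal (\<alpha> * ln (K * t + 1) / t - K * a)
      \<le> ennreal (K * a) + ennreal (\<alpha> - K * a)"
  proof -
    have "\<alpha> * ln (K * t + 1) / t \<le> \<alpha>" using ln assms by (simp add: field_simps)
    then show ?thesis by (intro add_left_mono ennreal_leI) simp
  qed
  \<comment> \<open>\<open>ennreal\<close> sends negative reals to 0, so recombining requires
    \<open>K * a \<le> \<alpha>\<close>, that is \<open>K \<le> K t + 1\<close>. This follows from
    \<open>1 - 1 / y \<le> ln y \<le> t\<close> at \<open>y = K t + 1\<close>.\<close>
  also have "\<dots> = ennreal \<alpha>"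
  proof -
    have "- ln (K * t + 1) = ln (1 / (K * t + 1))" using den by (simp add: ln_div)
    also have "\<dots> \<le> 1 / (K * t + 1) - 1" using den by (intro ln_le_minus_one) simp
    also have "\<dots> = - (K * t / (K * t + 1))" using den by (simp add: field_simps)
    finally have "K * t / (K * t + 1) \<le> t" using ln by linarith
    then have "K \<le> K * t + 1" using den assms(2) by (simp add: pos_divide_le_eq)
    then have "K * a \<le> \<alpha>"
      using den assms(3) by (simp add: a_def pos_divide_le_eq mult.commute)
    then show ?thesis using assms a by (subst ennreal_plus[symmetric]) auto
  qed
  finally show ?thesis .
qed

section \<open>Comparison with an independent uniform variable\<close>

lemma uniform01_emeasure_le:
  assumes "uniform01 M U" "0 \<le> x"
  shows "emeasure (distr M borel U) {..x} \<le> ennreal x"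
proof -
  have "emeasure (distr M borel U) {..x} = emeasure lborel ({0..1} \<inter> {..x})"
    using assms by (simp add: uniform01_def emeasure_uniform_measure divide_ennreal_def)
  also have "\<dots> \<le> emeasure lborel {0..x}" by (intro emeasure_mono) auto
  also have "\<dots> = ennreal x" using assms by simp
  finally show ?thesis .
qed

text \<open>Independence makes the joint law a product. Integrating over \<open>U\<close> first
  leaves the probability of \<open>U \<le> x\<close> at \<open>x = X \<omega>\<close>, which is at
  most \<open>x\<close>.\<close>

lemma (in prob_space) indep_uniform_le:
  assumes U: "uniform01 M U" and ind: "indep_var borel X borel U"
    and nonneg: "\<And>\<omega>. \<omega> \<in> space M \<Longrightarrow> 0 \<le> X \<omega>"
  shows "emeasure M {\<omega>\<in>space M. U \<omega> \<le> X \<omega>} \<le> (\<integral>\<^sup>+\<omega>. ennreal (X \<omega>) \<partial>M)"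
proof -
  have [measurable]: "random_variable borel U" "random_variable borel X"
    using U indep_var_rv1[OF ind] by (auto simp: uniform01_def)
  interpret U: prob_space "distr M borel U" by (rule prob_space_distr) simp
  have "{w \<in> space (borel \<Otimes>\<^sub>M borel). snd w \<le> fst w} \<in> sets (borel \<Otimes>\<^sub>M (borel :: real measure))"
    by measurable
  then have [measurable]: "{(x, u). u \<le> x} \<in> sets (borel \<Otimes>\<^sub>M (borel :: real measure))"
    by (simp add: space_pair_measure case_prod_unfold)
  have "emeasure M {\<omega>\<in>space M. U \<omega> \<le> X \<omega>}
      = emeasure (distr M (borel \<Otimes>\<^sub>M borel) (\<lambda>\<omega>. (X \<omega>, U \<omega>))) {(x, u). u \<le> x}"
    by (subst emeasure_distr) (auto intro!: arg_cong[where f="emeasure M"])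
  also have "distr M (borel \<Otimes>\<^sub>M borel) (\<lambda>\<omega>. (X \<omega>, U \<omega>)) = distr M borel X \<Otimes>\<^sub>M distr M borel U"
    using ind by (simp add: indep_var_distribution_eq)
  also have "emeasure \<dots> {(x, u). u \<le> x}
      = (\<integral>\<^sup>+x. emeasure (distr M borel U) (Pair x -` {(x, u). u \<le> x}) \<partial>distr M borel X)"
    by (rule U.emeasure_pair_measure_alt) simp
  also have "\<dots> = (\<integral>\<^sup>+\<omega>. emeasure (distr M borel U) {..X \<omega>} \<partial>M)"
    by (subst nn_integral_distr) (auto simp: vimage_def atMost_def)
  also have "\<dots> \<le> (\<integral>\<^sup>+\<omega>. ennreal (X \<omega>) \<partial>M)"
    by (intro nn_integral_mono uniform01_emeasure_le[OF U] nonneg)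
  finally show ?thesis .
qed

section \<open>Independence of functions of \<open>P\<close> from \<open>U\<close>\<close>

lemma measurable_vec_componentwise:
  fixes P :: "'a \<Rightarrow> real ^ 'k"
  assumes "\<And>k. (\<lambda>\<omega>. P \<omega> $ k) \<in> borel_measurable M"
  shows "P \<in> borel_measurable M"
  by (rule borel_measurable_euclidean_space[THEN iffD2])
    (use assms in \<open>auto simp: Basis_vec_def inner_axis\<close>)

text \<open>Turns independence of the generated sigma-algebras into \<open>indep_var\<close> for two
  real variables: preimages under \<open>g\<close> after \<open>P\<close> already lie in the
  sigma-algebra of \<open>P\<close>, and independence passes to subfamilies.\<close>

lemma (in prob_space) pvals_with_uniform_indep_var:
  fixes P :: "'a \<Rightarrow> real ^ 'k" and g :: "real ^ 'k \<Rightarrow> real"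
  assumes PU: "(P, U) \<in> pvals_with_uniform M" and [measurable]: "g \<in> borel_measurable borel"
  shows "indep_var borel (\<lambda>\<omega>. g (P \<omega>)) borel U"
proof -
  have P [measurable]: "P \<in> borel_measurable M" and U [measurable]: "U \<in> borel_measurable M"
    using PU by (auto simp: pvals_with_uniform_def uniform01_def intro!: measurable_vec_componentwise)
  have ind: "indep_set (sets (vimage_algebra (space M) P borel)) (sets (vimage_algebra (space M) U borel))"
    using PU by (auto simp: pvals_with_uniform_def)
  have "{(\<lambda>\<omega>. g (P \<omega>)) -` A \<inter> space M |A. A \<in> sets borel} \<subseteq> sets (vimage_algebra (space M) P borel)"
  proof safe
    fix A :: "real set" assume "A \<in> sets borel"
    then have "g -` A \<in> sets borel" using measurable_sets_borel[of g borel A] by simp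
    then have "P -` (g -` A) \<inter> space M \<in> sets (vimage_algebra (space M) P borel)"
      by (rule in_vimage_algebra)
    then show "(\<lambda>\<omega>. g (P \<omega>)) -` A \<inter> space M \<in> sets (vimage_algebra (space M) P borel)"
      by (simp add: vimage_def)
  qed
  moreover have "{U -` A \<inter> space M |A. A \<in> sets borel} \<subseteq> sets (vimage_algebra (space M) U borel)"
    by (auto intro: in_vimage_algebra)
  ultimately have "sigma_sets (space M) {(\<lambda>\<omega>. g (P \<omega>)) -` A \<inter> space M |A. A \<in> sets borel}
      \<subseteq> sets (vimage_algebra (space M) P borel)"
    "sigma_sets (space M) {U -` A \<inter> space M |A. A \<in> sets borel}
      \<subseteq> sets (vimage_algebra (space M) U borel)"
    using sets.sigma_sets_subset[of _ "vimage_algebra (space M) P borel"]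
      sets.sigma_sets_subset[of _ "vimage_algebra (space M) U borel"] by simp_all
  then have "indep_set (sigma_sets (space M) {(\<lambda>\<omega>. g (P \<omega>)) -` A \<inter> space M |A. A \<in> sets borel})
     (sigma_sets (space M) {U -` A \<inter> space M |A. A \<in> sets borel})"
    using ind unfolding indep_set_def
    by (elim indep_sets_mono_sets) (simp split: bool.split)
  then show ?thesis
    unfolding indep_var_eq by simp
qed

section \<open>Thresholds\<close>

text \<open>The disjunct \<open>1 < b\<close> accounts for the empty set, whose value is 1; for
  nonempty \<open>A\<close> it implies the first disjunct, since all members are below 1.\<close>

lemma inf_or_one_less_iff:
  assumes "A \<subseteq> {0<..<1}"
  shows "inf_or_one A < b \<longleftrightarrow> (\<exists>\<alpha>\<in>A. \<alpha> < b) \<or> 1 < b"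
proof (cases "A = {}")
  case False
  have "bdd_below A" using assms by (auto intro!: bdd_belowI[of _ 0])
  then have "inf_or_one A < b \<longleftrightarrow> (\<exists>\<alpha>\<in>A. \<alpha> < b)"
    using False by (simp add: inf_or_one_def cInf_less_iff)
  then show ?thesis using False assms by fastforce
qed (simp add: inf_or_one_def)

lemma inf_or_one_antimono:
  assumes "A \<subseteq> B" "B \<subseteq> {0<..<1}"
  shows "inf_or_one B \<le> inf_or_one A"
proof (rule dense_ge)
  fix b assume "inf_or_one A < b"
  then have "inf_or_one B < b" using assms by (auto simp: inf_or_one_less_iff)
  then show "inf_or_one B \<le> b" by simp
qed

lemma inf_or_one_range:
  assumes "A \<subseteq> {0<..<1}" shows "inf_or_one A \<in> {0..1}"
  \<comment> \<open>\<open>A\<close> lies between \<open>{}\<close> and \<open>{0<..<1}\<close>,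
    where \<open>inf_or_one\<close> takes the extreme values 1 and 0.\<close>
  using inf_or_one_antimono[OF _ assms, of "{}"] inf_or_one_antimono[OF assms]
  by (simp add: inf_or_one_def)

lemma inf_or_one_ge:
  assumes "0 \<le> c" shows "inf_or_one {\<alpha> \<in> {0<..<1}. c \<le> \<alpha>} = min c 1"
proof (cases "c < 1")
  case True
  have "{\<alpha> \<in> {0<..<1}. c \<le> \<alpha>} = (if c = 0 then {0<..<1} else {c..<1})"
    using assms by auto
  then show ?thesis using True by (simp add: inf_or_one_def)
next
  case False
  then have "{\<alpha> \<in> {0<..<1}. c \<le> \<alpha>} = {}" by auto
  then show ?thesis using False by (simp add: inf_or_one_def)
qed

text \<open>The common shape of \<open>F_UH\<close> and \<open>F_UH'\<close>, so that range,
  monotonicity and measurability are proved once for a general score \<open>\<Phi>\<close>.\<close>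

definition threshold :: "(real \<Rightarrow> real ^ 'k \<Rightarrow> ereal) \<Rightarrow> real ^ 'k \<Rightarrow> real \<Rightarrow> real" where
  "threshold \<Phi> p u = inf_or_one {\<alpha> \<in> {0<..<1}. \<Phi> \<alpha> p \<ge> ereal u}"

lemma threshold_range: "threshold \<Phi> p u \<in> {0..1}"
  unfolding threshold_def by (rule inf_or_one_range) auto

lemma threshold_less_iff:
  "threshold \<Phi> p u < b \<longleftrightarrow> (\<exists>\<alpha>. 0 < \<alpha> \<and> \<alpha> < 1 \<and> \<alpha> < b \<and> \<Phi> \<alpha> p \<ge> ereal u) \<or> 1 < b"
  unfolding threshold_def by (subst inf_or_one_less_iff) auto

text \<open>Varying the score and the point together yields both monotonicity in
  \<open>(p, u)\<close> and the dominations between thresholds.\<close>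

lemma threshold_mono:
  assumes "\<And>\<alpha>. 0 < \<alpha> \<Longrightarrow> \<Phi> \<alpha> q \<le> \<Psi> \<alpha> p" "u \<le> v"
  shows "threshold \<Psi> p u \<le> threshold \<Phi> q v"
  unfolding threshold_def
proof (intro inf_or_one_antimono subsetI)
  fix \<alpha> assume "\<alpha> \<in> {\<alpha> \<in> {0<..<1}. ereal v \<le> \<Phi> \<alpha> q}"
  then have \<alpha>: "0 < \<alpha>" "\<alpha> < 1" "ereal v \<le> \<Phi> \<alpha> q" by auto
  have "ereal u \<le> ereal v" using assms(2) by simp
  also note \<alpha>(3)
  also note assms(1)[OF \<alpha>(1)]
  finally show "\<alpha> \<in> {\<alpha> \<in> {0<..<1}. ereal u \<le> \<Psi> \<alpha> p}" using \<alpha> by simp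
qed auto

text \<open>A strict sublevel set is a union over levels \<open>\<alpha>\<close> of the events on
  which the score reaches \<open>u\<close>. By monotonicity in \<open>\<alpha>\<close>, a slightly
  larger rational can replace each level, so the union becomes countable.\<close>

lemma threshold_measurable:
  fixes \<Phi> :: "real \<Rightarrow> real ^ 'k::finite \<Rightarrow> ereal"
  assumes mono: "\<And>\<alpha> \<beta> p. 0 < \<alpha> \<Longrightarrow> \<alpha> \<le> \<beta> \<Longrightarrow> p \<in> unit_cube \<Longrightarrow> \<Phi> \<alpha> p \<le> \<Phi> \<beta> p"
    and [measurable]: "\<And>\<alpha>. \<Phi> \<alpha> \<in> borel_measurable borel"
  shows "(\<lambda>(p, u). threshold \<Phi> p u) \<in> borel_measurable (restrict_space borel (unit_cube \<times> {0..1}))"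
  unfolding borel_measurable_iff_less
proof
  fix a
  let ?N = "restrict_space borel (unit_cube \<times> {0..1}) :: ((real ^ 'k) \<times> real) measure"
  have [measurable]: "fst \<in> borel_measurable ?N" "snd \<in> borel_measurable ?N"
    by (auto intro!: measurable_restrict_space1 borel_measurable_continuous_onI continuous_intros)
  have less: "threshold \<Phi> (fst w) (snd w) < a \<longleftrightarrow>
      (\<exists>q::rat. 0 < real_of_rat q \<and> real_of_rat q < 1 \<and> real_of_rat q < a
        \<and> ereal (snd w) \<le> \<Phi> (real_of_rat q) (fst w)) \<or> 1 < a"
    if "fst w \<in> unit_cube" for w
  proof -
    have "\<exists>q::rat. 0 < real_of_rat q \<and> real_of_rat q < 1 \<and> real_of_rat q < a
        \<and> ereal (snd w) \<le> \<Phi> (real_of_rat q) (fst w)"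
      if "0 < \<alpha>" "\<alpha> < 1" "\<alpha> < a" "ereal (snd w) \<le> \<Phi> \<alpha> (fst w)" for \<alpha>
    proof -
      have "\<alpha> < min a 1" using that by simp
      then obtain q where q: "\<alpha> < real_of_rat q" "real_of_rat q < min a 1"
        using of_rat_dense by blast
      have "0 < real_of_rat q" using q that by linarith
      have "ereal (snd w) \<le> \<Phi> (real_of_rat q) (fst w)"
        using \<open>ereal (snd w) \<le> \<Phi> \<alpha> (fst w)\<close> \<open>0 < \<alpha>\<close> q \<open>fst w \<in> unit_cube\<close>
        by (elim order_trans) (intro mono, auto)
      with \<open>0 < real_of_rat q\<close> show ?thesis using q by (intro exI[of _ q]) auto
    qed
    then show ?thesis unfolding threshold_less_iff by blast
  qed
  have "{w \<in> space ?N. (case w of (p, u) \<Rightarrow> threshold \<Phi> p u) < a} =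
    {w \<in> space ?N. (\<exists>q::rat. 0 < real_of_rat q \<and> real_of_rat q < 1 \<and> real_of_rat q < a
        \<and> ereal (snd w) \<le> \<Phi> (real_of_rat q) (fst w)) \<or> 1 < a}"
    using less by (auto simp: space_restrict_space case_prod_unfold)
  also have "\<dots> \<in> sets ?N" by measurable
  finally show "{w \<in> space ?N. (case w of (p, u) \<Rightarrow> threshold \<Phi> p u) < a} \<in> sets ?N" .
qed

section \<open>The two scores, with extended real quotients\<close>

definition shifted_reciprocal :: "real \<Rightarrow> real \<Rightarrow> real \<Rightarrow> ereal" where
  "shifted_reciprocal t \<alpha> x = ereal \<alpha> / ereal (t * x) - ereal (1 / t)"

lemma shifted_reciprocal_pos:
  "0 < t \<Longrightarrow> 0 < x \<Longrightarrow> shifted_reciprocal t \<alpha> x = ereal (\<alpha> / (t * x) - 1 / t)"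
  by (simp add: shifted_reciprocal_def)

lemma shifted_reciprocal_zero: "0 < \<alpha> \<Longrightarrow> shifted_reciprocal t \<alpha> 0 = \<infinity>"
  by (simp add: shifted_reciprocal_def)

lemma shifted_reciprocal_mono:
  assumes "0 < t" "0 < \<alpha>" "\<alpha> \<le> \<beta>" "0 \<le> y" "y \<le> x"
  shows "shifted_reciprocal t \<alpha> x \<le> shifted_reciprocal t \<beta> y"
proof (cases "y = 0")
  case False
  then have "\<alpha> / (t * x) \<le> \<beta> / (t * y)" using assms by (intro frac_le) auto
  then show ?thesis using False assms by (simp add: shifted_reciprocal_pos)
qed (use assms in \<open>simp add: shifted_reciprocal_zero\<close>)

lemma measurable_shifted_reciprocal [measurable]:
  "shifted_reciprocal t \<alpha> \<in> borel_measurable borel"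
  unfolding shifted_reciprocal_def[abs_def] by measurable

definition score :: "real ^ 'k \<Rightarrow> real \<Rightarrow> ereal" where
  "score p \<alpha> = ereal (1 / real CARD('k)) * (\<Sum>k\<in>UNIV. shifted_reciprocal (T CARD('k)) \<alpha> (p $ k))"

definition score_pos :: "real ^ 'k \<Rightarrow> real \<Rightarrow> ereal" where
  "score_pos p \<alpha> =
     ereal (1 / real CARD('k)) * (\<Sum>k\<in>UNIV. max (shifted_reciprocal (T CARD('k)) \<alpha> (p $ k)) 0)"

lemma F_UH_eq_threshold: "F_UH = threshold (\<lambda>\<alpha> p. score_pos p \<alpha>)"
  by (intro ext) (simp add: F_UH_def threshold_def score_pos_def shifted_reciprocal_def)

lemma F_UH'_eq_threshold: "F_UH' = threshold (\<lambda>\<alpha> p. score p \<alpha>)"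
  by (intro ext) (simp add: F_UH'_def threshold_def score_def shifted_reciprocal_def)

lemma measurable_component [measurable]: "(\<lambda>p :: real ^ 'k::finite. p $ k) \<in> borel_measurable borel"
  by (intro borel_measurable_continuous_onI continuous_intros)

lemma measurable_score [measurable]:
  "(\<lambda>p :: real ^ 'k::finite. score p \<alpha>) \<in> borel_measurable borel"
  "(\<lambda>p :: real ^ 'k::finite. score_pos p \<alpha>) \<in> borel_measurable borel"
  unfolding score_def score_pos_def by measurable

lemma score_mono:
  fixes p q :: "real ^ 'k::finite"
  assumes "2 \<le> CARD('k)" "0 < \<alpha>" "\<alpha> \<le> \<beta>" "q \<in> unit_cube" "\<And>k. q $ k \<le> p $ k"
  shows "score p \<alpha> \<le> score q \<beta>" "score_pos p \<alpha> \<le> score_pos q \<beta>"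
  unfolding score_def score_pos_def
  using assms T_pos[OF assms(1)]
  by (auto intro!: ereal_mult_left_mono sum_mono max.mono shifted_reciprocal_mono simp: unit_cube_def)

lemma score_le_score_pos: "score p \<alpha> \<le> score_pos p \<alpha>"
  unfolding score_def score_pos_def by (intro ereal_mult_left_mono sum_mono) auto

lemma score_zero:
  fixes p :: "real ^ 'k::finite"
  assumes "p $ k = 0" "0 < \<alpha>"
  shows "score p \<alpha> = \<infinity>" "score_pos p \<alpha> = \<infinity>"
proof -
  have "shifted_reciprocal (T CARD('k)) \<alpha> (p $ k) = \<infinity>"
    using assms by (simp add: shifted_reciprocal_zero)
  then have "(\<Sum>k\<in>UNIV. shifted_reciprocal (T CARD('k)) \<alpha> (p $ k)) = \<infinity>"
    "(\<Sum>k\<in>UNIV. max (shifted_reciprocal (T CARD('k)) \<alpha> (p $ k)) 0) = \<infinity>"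
    unfolding sum_Pinfty by (auto intro!: exI[of _ k])
  then show "score p \<alpha> = \<infinity>" "score_pos p \<alpha> = \<infinity>"
    by (simp_all add: score_def score_pos_def)
qed

lemma score_real:
  fixes p :: "real ^ 'k::finite"
  assumes "2 \<le> CARD('k)" "\<And>k. 0 < p $ k"
  defines "t \<equiv> T CARD('k)"
  shows "score p \<alpha> = ereal (1 / real CARD('k) * (\<Sum>k\<in>UNIV. \<alpha> / (t * p $ k) - 1 / t))"
    "score_pos p \<alpha> = ereal (1 / real CARD('k) * (\<Sum>k\<in>UNIV. max (\<alpha> / (t * p $ k) - 1 / t) 0))"
  using T_pos[OF assms(1)] assms(2)
  by (simp_all add: score_def score_pos_def t_def shifted_reciprocal_pos
    ereal_max[symmetric] zero_ereal_def del: ereal_max)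

text \<open>A zero component makes both scores infinite at every \<open>\<alpha> > 0\<close>, so
  every level in \<open>{0<..<1}\<close> qualifies. This settles the degenerate case of both closed
  forms; elsewhere on the cube the scores are real.\<close>

lemma F_UH_zero:
  fixes p :: "real ^ 'k::finite"
  assumes "p $ k = 0"
  shows "F_UH p u = 0" "F_UH' p u = 0"
proof -
  have "{\<alpha> \<in> {0<..<1}. score_pos p \<alpha> \<ge> ereal u} = {0<..<1}"
    "{\<alpha> \<in> {0<..<1}. score p \<alpha> \<ge> ereal u} = {0<..<1}"
    using assms by (auto simp: score_zero)
  then show "F_UH p u = 0" "F_UH' p u = 0"
    by (simp_all add: F_UH_eq_threshold F_UH'_eq_threshold threshold_def inf_or_one_def)
qed

section \<open>Closed form of \<open>F_UH'\<close>\<close>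

lemma H_nonneg: "p \<in> unit_cube \<Longrightarrow> 0 \<le> H p"
  by (auto simp: H_def harmonic_mean_def unit_cube_def intro!: divide_nonneg_nonneg sum_nonneg)

text \<open>With \<open>S\<close> the sum of reciprocals, the score is the affine function
  \<open>(\<alpha> S - K) / (K t)\<close>. It reaches \<open>u\<close> once \<open>\<alpha>\<close>
  is at least \<open>(t u + 1) K / S\<close>, and \<open>K / S\<close> is the harmonic mean. The cap
  at 1 is the default value of \<open>inf_or_one\<close>.\<close>

lemma F_UH'_formula:
  fixes p :: "real ^ 'k::finite"
  assumes K: "2 \<le> CARD('k)" and p: "p \<in> unit_cube" and u: "0 \<le> u"
  shows "F_UH' p u = min ((T CARD('k) * u + 1) * H p) 1"
proof (cases "\<exists>k. p $ k = 0")
  case True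
  then show ?thesis by (auto simp: F_UH_zero H_def harmonic_mean_def)
next
  case False
  then have pos: "0 < p $ k" for k
    using p by (auto simp: unit_cube_def less_le)
  define t where "t = T CARD('k)"
  have t: "0 < t" using T_pos[OF K] by (simp add: t_def)
  define S where "S = (\<Sum>k\<in>UNIV. 1 / p $ k)"
  have S: "0 < S" unfolding S_def using pos by (intro sum_pos) auto
  have "score p \<alpha> \<ge> ereal u \<longleftrightarrow> (t * u + 1) * H p \<le> \<alpha>" for \<alpha>
  proof -
    have "(\<Sum>k\<in>UNIV. \<alpha> / (t * p $ k) - 1 / t) = (\<alpha> * S - real CARD('k)) / t"
      by (simp add: S_def sum_subtractf sum_distrib_left sum_divide_distrib diff_divide_distrib mult.commute)
    then have "score p \<alpha> = ereal (1 / real CARD('k) * ((\<alpha> * S - real CARD('k)) / t))"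
      by (simp add: score_real(1)[OF K pos] flip: t_def)
    moreover have "H p = real CARD('k) / S"
      using False by (auto simp: H_def harmonic_mean_def S_def)
    moreover have "u \<le> 1 / real CARD('k) * ((\<alpha> * S - real CARD('k)) / t)
        \<longleftrightarrow> (t * u + 1) * (real CARD('k) / S) \<le> \<alpha>"
      using t S by (simp add: field_simps)
    ultimately show ?thesis by simp
  qed
  then have "F_UH' p u = inf_or_one {\<alpha> \<in> {0<..<1}. (t * u + 1) * H p \<le> \<alpha>}"
    by (simp add: F_UH'_eq_threshold threshold_def)
  also have "\<dots> = min ((t * u + 1) * H p) 1"
    using t u H_nonneg[OF p] by (intro inf_or_one_ge) auto
  finally show ?thesis by (simp add: t_def)
qed

text \<open>Viewing \<open>F_H'\<close> as the slice \<open>u = 1\<close> of \<open>F_UH'\<close>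
  gives it the range, monotonicity and measurability of a threshold.\<close>

lemma F_H'_eq_F_UH':
  fixes p :: "real ^ 'k::finite"
  assumes "2 \<le> CARD('k)" "p \<in> unit_cube"
  shows "F_H' p u = F_UH' p 1"
  using assms by (simp add: F_UH'_formula F_H'_def)

section \<open>Order statistics and the closed form of \<open>F_UH\<close>\<close>

lemma length_order_stats [simp]: "length (order_stats (p :: real ^ 'k::finite)) = CARD('k)"
  by (simp add: order_stats_def flip: size_mset)

lemma sorted_order_stats: "sorted (order_stats p)"
  by (simp add: order_stats_def)

lemma set_order_stats: "set (order_stats (p :: real ^ 'k::finite)) = range (($) p)"
  by (simp add: order_stats_def)

lemma sum_order_stats:
  fixes p :: "real ^ 'k::finite"
  shows "(\<Sum>k\<in>UNIV. g (p $ k)) = (\<Sum>i<CARD('k). g (order_stats p ! i) :: real)"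
proof -
  have "(\<Sum>k\<in>UNIV. g (p $ k)) = sum_mset (image_mset g (mset (order_stats p)))"
    by (simp add: order_stats_def sum_unfold_sum_mset multiset.map_comp comp_def)
  also have "\<dots> = sum_list (map g (order_stats p))"
    by (simp flip: sum_mset_sum_list)
  also have "\<dots> = (\<Sum>i<CARD('k). g (order_stats p ! i))"
    by (simp add: sum_list_sum_nth lessThan_atLeast0)
  finally show ?thesis .
qed

text \<open>The nonnegative terms of a decreasing sequence form an initial segment, so the sum of
  positive parts is itself a partial sum; conversely it bounds every partial sum.\<close>

lemma sum_max_zero_ge_iff:
  fixes f :: "nat \<Rightarrow> real"
  assumes anti: "\<And>i j. i \<le> j \<Longrightarrow> j < n \<Longrightarrow> f j \<le> f i" and c: "0 < c"
  shows "c \<le> (\<Sum>i<n. max (f i) 0) \<longleftrightarrow> (\<exists>m\<in>{1..n}. c \<le> (\<Sum>i<m. f i))"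
proof
  assume "c \<le> (\<Sum>i<n. max (f i) 0)"
  moreover have "\<exists>m\<le>n. (\<Sum>i<n. max (f i) 0) = (\<Sum>i<m. f i)"
    using anti
  proof (induction n)
    case (Suc n)
    show ?case
    proof (cases "0 \<le> f n")
      case True
      then have "0 \<le> f i" if "i < Suc n" for i using Suc.prems[of i n] that by force
      then have "(\<Sum>i<Suc n. max (f i) 0) = (\<Sum>i<Suc n. f i)"
        by (intro sum.cong) auto
      then show ?thesis by blast
    next
      case False
      obtain m where "m \<le> n" "(\<Sum>i<n. max (f i) 0) = (\<Sum>i<m. f i)"
        using Suc.IH Suc.prems by auto
      then show ?thesis using False by (intro exI[of _ m]) auto
    qed
  qed simp
  ultimately obtain m where m: "m \<le> n" "c \<le> (\<Sum>i<m. f i)" by auto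
  \<comment> \<open>The empty partial sum is 0 and cannot reach \<open>c > 0\<close>; in the closed
    form this positivity comes from \<open>u > 0\<close>.\<close>
  moreover have "m \<noteq> 0" using m c by (intro notI) simp
  ultimately show "\<exists>m\<in>{1..n}. c \<le> (\<Sum>i<m. f i)" by (intro bexI[of _ m]) auto
next
  assume "\<exists>m\<in>{1..n}. c \<le> (\<Sum>i<m. f i)"
  then obtain m where m: "m \<le> n" "c \<le> (\<Sum>i<m. f i)" by auto
  have "(\<Sum>i<m. f i) \<le> (\<Sum>i<m. max (f i) 0)" by (intro sum_mono) auto
  also have "\<dots> \<le> (\<Sum>i<n. max (f i) 0)" using m by (intro sum_mono2) auto
  finally show "c \<le> (\<Sum>i<n. max (f i) 0)" using m by simp
qed

text \<open>Along the order statistics the summands decrease, so the positive-part score reaches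
  \<open>u\<close> exactly when the partial sum over the \<open>m\<close> smallest p-values reaches
  \<open>K u\<close> for some \<open>m\<close>. That inequality is affine in \<open>\<alpha>\<close>
  with solution \<open>c m \<le> \<alpha>\<close>, and the union over \<open>m\<close> is governed
  by the minimum of the \<open>c m\<close>.\<close>

lemma F_UH_formula:
  fixes p :: "real ^ 'k::finite"
  assumes K: "2 \<le> CARD('k)" and p: "p \<in> unit_cube" and u: "0 < u"
  shows "F_UH p u = min (MIN m\<in>{1..CARD('k)}.
    (u * real CARD('k) * T CARD('k) / real m + 1) * H_smallest m p) 1"
proof -
  define t where "t = T CARD('k)"
  have t: "0 < t" using T_pos[OF K] by (simp add: t_def)
  define x where "x i = order_stats p ! i" for i
  define c where "c m = (u * real CARD('k) * t / real m + 1) * H_smallest m p" for m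
  have x_mono: "x i \<le> x j" if "i \<le> j" "j < CARD('k)" for i j
    using sorted_order_stats[of p] that by (simp add: x_def sorted_nth_mono)
  have x_in: "x i \<in> range (($) p)" if "i < CARD('k)" for i
    using that nth_mem[of i "order_stats p"] by (simp add: x_def set_order_stats)
  then have x_nonneg: "0 \<le> x i" if "i < CARD('k)" for i
    using that p by (force simp: unit_cube_def)
  have c_nonneg: "0 \<le> c m" if "m \<in> {1..CARD('k)}" for m
    using that t u x_nonneg
    by (auto simp: c_def H_smallest_def harmonic_mean_def x_def
        intro!: mult_nonneg_nonneg add_nonneg_nonneg divide_nonneg_nonneg sum_nonneg)
  have "F_UH p u = min (Min (c ` {1..CARD('k)})) 1"
  proof (cases "\<exists>k. p $ k = 0")
    case True
    then obtain k where k: "p $ k = 0" by auto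
    then obtain i where i: "i < CARD('k)" "x i = 0"
      using set_order_stats[of p] by (metis in_set_conv_nth length_order_stats rangeI x_def)
    \<comment> \<open>The smallest order statistic is then 0, so the term \<open>m = 1\<close>
      vanishes; as no term is negative, it is the minimum.\<close>
    then have "x 0 = 0" using x_mono[of 0 i] x_nonneg[of 0] by auto
    then have "c 1 = 0" by (auto simp: c_def H_smallest_def harmonic_mean_def x_def)
    moreover have "1 \<in> {1..CARD('k)}" using K by simp
    ultimately have "Min (c ` {1..CARD('k)}) = 0"
      using c_nonneg by (intro Min_eqI) (auto simp: image_iff)
    then show ?thesis using k by (simp add: F_UH_zero)
  next
    case False
    then have pos: "0 < p $ k" for k
      using p by (auto simp: unit_cube_def less_le)
    have x_pos: "0 < x i" if "i < CARD('k)" for i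
      using x_in[OF that] pos by auto
    have iff: "score_pos p \<alpha> \<ge> ereal u \<longleftrightarrow> Min (c ` {1..CARD('k)}) \<le> \<alpha>" if "0 < \<alpha>" for \<alpha>
    proof -
      have "score_pos p \<alpha> \<ge> ereal u \<longleftrightarrow>
          real CARD('k) * u \<le> (\<Sum>k\<in>UNIV. max (\<alpha> / (t * p $ k) - 1 / t) 0)"
        using K by (simp add: score_real(2)[OF K pos] field_simps flip: t_def)
      also have "\<dots> \<longleftrightarrow> real CARD('k) * u \<le> (\<Sum>i<CARD('k). max (\<alpha> / (t * x i) - 1 / t) 0)"
        using sum_order_stats[of "\<lambda>y. max (\<alpha> / (t * y) - 1 / t) 0" p] by (simp add: x_def)
      also have "\<dots> \<longleftrightarrow> (\<exists>m\<in>{1..CARD('k)}. real CARD('k) * u \<le> (\<Sum>i<m. \<alpha> / (t * x i) - 1 / t))"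
        using t u x_mono x_pos \<open>0 < \<alpha>\<close>
        by (intro sum_max_zero_ge_iff) (auto intro!: divide_left_mono mult_pos_pos)
      also have "\<dots> \<longleftrightarrow> (\<exists>m\<in>{1..CARD('k)}. c m \<le> \<alpha>)"
      proof (intro bex_cong refl)
        fix m assume m: "m \<in> {1..CARD('k)}"
        define S where "S = (\<Sum>i<m. 1 / x i)"
        have S: "0 < S" unfolding S_def using m x_pos by (intro sum_pos) (auto simp: lessThan_empty_iff)
        have "order_stats p ! i \<noteq> 0" if "i < m" for i
          using x_pos[of i] that m by (auto simp: x_def)
        then have H: "H_smallest m p = real m / S"
          by (auto simp: H_smallest_def harmonic_mean_def S_def x_def)
        have "(\<Sum>i<m. \<alpha> / (t * x i) - 1 / t) = (\<alpha> * S - real m) / t"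
          by (simp add: S_def sum_subtractf sum_distrib_left sum_divide_distrib diff_divide_distrib mult.commute)
        moreover have "c m = (real CARD('k) * u * t + real m) / S"
        proof -
          have "real m \<noteq> 0" using m by auto
          then show ?thesis using S by (simp add: c_def H field_simps)
        qed
        ultimately show "real CARD('k) * u \<le> (\<Sum>i<m. \<alpha> / (t * x i) - 1 / t) \<longleftrightarrow> c m \<le> \<alpha>"
          using t S by (simp add: pos_le_divide_eq pos_divide_le_eq algebra_simps)
      qed
      also have "\<dots> \<longleftrightarrow> Min (c ` {1..CARD('k)}) \<le> \<alpha>"
        using K by (subst Min_le_iff) auto
      finally show ?thesis .
    qed
    then have "{\<alpha> \<in> {0<..<1}. score_pos p \<alpha> \<ge> ereal u} = {\<alpha> \<in> {0<..<1}. Min (c ` {1..CARD('k)}) \<le> \<alpha>}"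
      by auto
    moreover have "0 \<le> Min (c ` {1..CARD('k)})"
      using K c_nonneg by (subst Min_ge_iff) auto
    ultimately show ?thesis
      unfolding F_UH_eq_threshold threshold_def by (simp only: inf_or_one_ge)
  qed
  then show ?thesis by (simp add: c_def[abs_def] t_def)
qed

section \<open>Validity and domination\<close>

text \<open>If some component is at or below the cutoff, its capped value \<open>n\<close> alone
  lifts the average to at least 1, hence to \<open>u\<close>. Otherwise all components are positive,
  the cap is inactive, and the average is the positive-part score at
  \<open>\<alpha>\<close>.\<close>

lemma F_UH_le_imp:
  fixes p :: "real ^ 'k::finite"
  assumes K: "2 \<le> CARD('k)" and p: "p \<in> unit_cube" and u: "u \<le> 1"
    and \<alpha>: "0 < \<alpha>" "\<alpha> < 1" and le: "F_UH p u \<le> \<alpha>"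
  defines "n \<equiv> real CARD('k)" and "t \<equiv> T CARD('k)"
  shows "u \<le> (\<Sum>k\<in>UNIV. truncated_calibrator n t \<alpha> (p $ k)) / n"
proof (cases "\<exists>k. p $ k \<le> \<alpha> / (n * t + 1)")
  case True
  then obtain k where k: "p $ k \<le> \<alpha> / (n * t + 1)" by auto
  then have "n = truncated_calibrator n t \<alpha> (p $ k)"
    by (simp add: truncated_calibrator_def)
  also have "\<dots> \<le> (\<Sum>k\<in>UNIV. truncated_calibrator n t \<alpha> (p $ k))"
    by (intro member_le_sum) (auto simp: n_def intro: truncated_calibrator_nonneg)
  finally have "1 \<le> (\<Sum>k\<in>UNIV. truncated_calibrator n t \<alpha> (p $ k)) / n"
    by (simp add: n_def)
  then show ?thesis using u by linarith
next
  case False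
  have t: "0 < t" using T_pos[OF K] by (simp add: t_def)
  have "0 \<le> \<alpha> / (n * t + 1)" using t \<alpha> by (simp add: n_def)
  then have pos: "0 < p $ k" for k using False by (meson le_less_trans not_less)
  define g where "g \<beta> = 1 / n * (\<Sum>k\<in>UNIV. max (\<beta> / (t * p $ k) - 1 / t) 0)" for \<beta>
  have score: "score_pos p \<beta> = ereal (g \<beta>)" for \<beta>
    by (simp add: score_real(2)[OF K pos] g_def n_def t_def)
  \<comment> \<open>An infimum at most \<open>\<alpha>\<close> only provides qualifying levels below
    each \<open>\<beta> > \<alpha>\<close>. Monotonicity gives the bound at \<open>\<beta>\<close>,
    and continuity of \<open>g\<close> carries it to \<open>\<alpha>\<close> from the right.\<close>
  have "u \<le> g \<beta>" if \<beta>: "\<alpha> < \<beta>" "\<beta> < 1" for \<beta>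
  proof -
    have "F_UH p u < \<beta>" using le \<beta> by simp
    then obtain \<gamma> where \<gamma>: "0 < \<gamma>" "\<gamma> < \<beta>" "ereal u \<le> score_pos p \<gamma>"
      using \<beta> unfolding F_UH_eq_threshold threshold_less_iff by auto
    note \<gamma>(3)
    also have "score_pos p \<gamma> \<le> score_pos p \<beta>"
      using \<gamma> p by (intro score_mono(2)[OF K]) auto
    finally show ?thesis by (simp add: score)
  qed
  then have "eventually (\<lambda>\<beta>. u \<le> g \<beta>) (at_right \<alpha>)"
    using \<alpha> by (auto simp: eventually_at_right)
  moreover have "(g \<longlongrightarrow> g \<alpha>) (at_right \<alpha>)"
    unfolding g_def using t pos[THEN less_imp_neq] by (intro tendsto_intros) (auto dest: sym)
  ultimately have "u \<le> g \<alpha>"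
    by (intro tendsto_lowerbound[of g "g \<alpha>" "at_right \<alpha>"]) auto
  then show ?thesis using False by (simp add: g_def truncated_calibrator_def)
qed

text \<open>The event is contained in \<open>U \<le> g P\<close>, whose probability is at most the
  expectation of \<open>g P\<close>. Linearity reduces this to the marginals, whatever the
  dependence among the components of \<open>P\<close>.\<close>

lemma F_UH_prob_le:
  fixes P :: "'a \<Rightarrow> real ^ 'k::finite"
  assumes M: "prob_space M" and K: "2 \<le> CARD('k)"
    and PU: "(P, U) \<in> pvals_with_uniform M" and \<alpha>: "0 < \<alpha>" "\<alpha> < 1"
  shows "measure M {\<omega>\<in>space M. P \<omega> \<in> unit_cube \<and> U \<omega> \<in> {0..1} \<and> F_UH (P \<omega>) (U \<omega>) \<le> \<alpha>} \<le> \<alpha>"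
proof -
  interpret prob_space M by (rule M)
  define n t where "n = real CARD('k)" and "t = T CARD('k)"
  have n: "0 < n" and t: "0 < t" using K T_pos[OF K] by (auto simp: n_def t_def)
  define g :: "real ^ 'k \<Rightarrow> real"
    where "g p = (\<Sum>k\<in>UNIV. truncated_calibrator n t \<alpha> (p $ k)) / n" for p
  have [measurable]: "g \<in> borel_measurable borel"
    unfolding g_def[abs_def] by measurable
  have unif: "uniform01 M U" "\<And>k. uniform01 M (\<lambda>\<omega>. P \<omega> $ k)"
    using PU by (auto simp: pvals_with_uniform_def)
  then have P_comp [measurable]: "(\<lambda>\<omega>. P \<omega> $ k) \<in> borel_measurable M" for k
    by (auto simp: uniform01_def)
  then have [measurable]: "P \<in> borel_measurable M" by (rule measurable_vec_componentwise)
  have [measurable]: "U \<in> borel_measurable M" using unif by (auto simp: uniform01_def)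
  have g_nonneg: "0 \<le> g p" for p
    using n by (auto simp: g_def intro!: sum_nonneg truncated_calibrator_nonneg divide_nonneg_nonneg)
  have "emeasure M {\<omega>\<in>space M. P \<omega> \<in> unit_cube \<and> U \<omega> \<in> {0..1} \<and> F_UH (P \<omega>) (U \<omega>) \<le> \<alpha>}
      \<le> emeasure M {\<omega>\<in>space M. U \<omega> \<le> g (P \<omega>)}"
    using F_UH_le_imp[OF K _ _ \<alpha>] by (intro emeasure_mono) (auto simp: g_def n_def t_def)
  also have "\<dots> \<le> (\<integral>\<^sup>+\<omega>. ennreal (g (P \<omega>)) \<partial>M)"
    by (intro indep_uniform_le pvals_with_uniform_indep_var[OF PU] unif g_nonneg) measurable
  also have "\<dots> = (\<integral>\<^sup>+\<omega>. (\<Sum>k\<in>UNIV. ennreal (truncated_calibrator n t \<alpha> (P \<omega> $ k))) * ennreal (1 / n) \<partial>M)"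
    using n by (intro nn_integral_cong)
      (simp add: g_def divide_inverse ennreal_mult' truncated_calibrator_nonneg sum_nonneg)
  also have "\<dots> = (\<Sum>k\<in>UNIV. \<integral>\<^sup>+\<omega>. ennreal (truncated_calibrator n t \<alpha> (P \<omega> $ k)) \<partial>M) * ennreal (1 / n)"
    by (simp add: nn_integral_multc nn_integral_sum)
  also have "\<dots> \<le> (\<Sum>k\<in>(UNIV :: 'k set). ennreal \<alpha>) * ennreal (1 / n)"
  proof (intro mult_right_mono sum_mono)
    fix k
    have "(\<integral>\<^sup>+\<omega>. ennreal (truncated_calibrator n t \<alpha> (P \<omega> $ k)) \<partial>M)
        = (\<integral>\<^sup>+x. ennreal (truncated_calibrator n t \<alpha> x) \<partial>distr M borel (\<lambda>\<omega>. P \<omega> $ k))"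
      by (subst nn_integral_distr) auto
    also have "distr M borel (\<lambda>\<omega>. P \<omega> $ k) = uniform_measure lborel {0..1}"
      using unif(2) by (simp add: uniform01_def)
    also have "(\<integral>\<^sup>+x. ennreal (truncated_calibrator n t \<alpha> x) \<partial>\<dots>) \<le> ennreal \<alpha>"
      \<comment> \<open>The choice of \<open>T K\<close> enters here: \<open>ln_KT_le_T\<close> is
        what bounds each marginal integral by \<open>\<alpha>\<close>.\<close>
      using n t \<alpha> ln_KT_le_T[OF K] by (intro nn_integral_truncated_calibrator) (auto simp: n_def t_def)
    finally show "(\<integral>\<^sup>+\<omega>. ennreal (truncated_calibrator n t \<alpha> (P \<omega> $ k)) \<partial>M) \<le> ennreal \<alpha>" .
  qed simp
  also have "\<dots> = ennreal \<alpha>"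
    using n \<alpha> by (simp add: n_def ennreal_of_nat_eq_real_of_nat flip: ennreal_mult')
  finally show ?thesis
    using \<alpha> by (simp add: emeasure_eq_measure)
qed

lemma F_UH_merging:
  assumes "prob_space M" and K: "2 \<le> CARD('k::finite)"
  shows "randomized_p_merging M (F_UH :: real ^ 'k \<Rightarrow> real \<Rightarrow> real)"
  unfolding randomized_p_merging_def
proof (intro conjI ballI impI)
  show "F_UH p u \<in> {0..1}" for p :: "real ^ 'k" and u
    unfolding F_UH_eq_threshold by (rule threshold_range)
  show "F_UH p u \<le> F_UH q v"
    if "p \<in> unit_cube" "\<forall>k. p $ k \<le> q $ k" "u \<le> v" for p q :: "real ^ 'k" and u v
    unfolding F_UH_eq_threshold using that by (intro threshold_mono score_mono[OF K]) auto
  show "(\<lambda>(p, u). F_UH p u) \<in> borel_measurable (restrict_space borel ((unit_cube :: (real ^ 'k) set) \<times> {0..1}))"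
    unfolding F_UH_eq_threshold
    by (intro threshold_measurable score_mono[OF K]) auto
  fix \<alpha> :: real and PU :: "('a \<Rightarrow> real ^ 'k) \<times> ('a \<Rightarrow> real)"
  assume "\<alpha> \<in> {0<..<1}" "PU \<in> pvals_with_uniform M"
  then show "case PU of (P, U) \<Rightarrow> measure M {\<omega> \<in> space M. P \<omega> \<in> unit_cube \<and> U \<omega> \<in> {0..1} \<and>
      F_UH (P \<omega>) (U \<omega>) \<le> \<alpha>} \<le> \<alpha>"
    using F_UH_prob_le[OF assms] by auto
qed

section \<open>Transfer of validity along domination\<close>

text \<open>Monotonicity of \<open>measure\<close> asks for a measurable larger event. The cube is
  closed, so measurable sets of the restricted space are Borel and pull back along
  \<open>(P, U)\<close>.\<close>

lemma measurable_pvals_le: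
  fixes F :: "real ^ 'k::finite \<Rightarrow> real \<Rightarrow> real"
  assumes F: "(\<lambda>(p, u). F p u) \<in> borel_measurable (restrict_space borel (unit_cube \<times> {0..1}))"
    and PU: "(P, U) \<in> pvals_with_uniform M"
  shows "{\<omega>\<in>space M. P \<omega> \<in> unit_cube \<and> U \<omega> \<in> {0..1} \<and> F (P \<omega>) (U \<omega>) \<le> \<alpha>} \<in> sets M"
proof -
  have comp [measurable]: "(\<lambda>\<omega>. P \<omega> $ k) \<in> borel_measurable M" for k
    using PU by (auto simp: pvals_with_uniform_def uniform01_def)
  then have [measurable]: "P \<in> borel_measurable M" by (rule measurable_vec_componentwise)
  have [measurable]: "U \<in> borel_measurable M"
    using PU by (auto simp: pvals_with_uniform_def uniform01_def)
  let ?C = "(unit_cube :: (real ^ 'k) set) \<times> {0..1::real}"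
  have cube: "?C \<in> sets borel"
  proof -
    have "(unit_cube :: (real ^ 'k) set) = (\<Inter>k. {p. 0 \<le> p $ k} \<inter> {p. p $ k \<le> 1})"
      by (auto simp: unit_cube_def)
    moreover have "closed \<dots>"
      by (intro closed_INT ballI closed_Int closed_Collect_le continuous_intros)
    ultimately have "closed ?C" by (intro closed_Times) auto
    then show ?thesis by simp
  qed
  have "{w \<in> space (restrict_space borel ?C). (\<lambda>(p, u). F p u) w \<le> \<alpha>} \<in> sets (restrict_space borel ?C)"
    using F unfolding borel_measurable_iff_le by blast
  then have "{w \<in> ?C. (\<lambda>(p, u). F p u) w \<le> \<alpha>} \<in> sets borel"
    using cube by (subst (asm) sets_restrict_space_iff) (auto simp: space_restrict_space)
  moreover have "(\<lambda>\<omega>. (P \<omega>, U \<omega>)) \<in> borel_measurable M" by measurable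
  ultimately have "(\<lambda>\<omega>. (P \<omega>, U \<omega>)) -` {w \<in> ?C. (\<lambda>(p, u). F p u) w \<le> \<alpha>} \<inter> space M \<in> sets M"
    by (rule measurable_sets[rotated])
  also have "(\<lambda>\<omega>. (P \<omega>, U \<omega>)) -` {w \<in> ?C. (\<lambda>(p, u). F p u) w \<le> \<alpha>} \<inter> space M =
      {\<omega>\<in>space M. P \<omega> \<in> unit_cube \<and> U \<omega> \<in> {0..1} \<and> F (P \<omega>) (U \<omega>) \<le> \<alpha>}"
    by auto
  finally show ?thesis .
qed

text \<open>A pointwise larger function has a smaller rejection event, so error control passes from
  \<open>F\<close> to \<open>G\<close>. The other three properties do not follow from domination and
  are assumed for \<open>G\<close>.\<close>

lemma randomized_p_merging_dominated:
  fixes F G :: "real ^ 'k::finite \<Rightarrow> real \<Rightarrow> real"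
  assumes "prob_space M" and F: "randomized_p_merging M F" and dom: "dominates F G"
    and range: "\<And>p u. p \<in> unit_cube \<Longrightarrow> u \<in> {0..1} \<Longrightarrow> G p u \<in> {0..1}"
    and mono: "\<And>p q u v. p \<in> unit_cube \<Longrightarrow> q \<in> unit_cube \<Longrightarrow> u \<in> {0..1} \<Longrightarrow> v \<in> {0..1} \<Longrightarrow>
      (\<And>k. p $ k \<le> q $ k) \<Longrightarrow> u \<le> v \<Longrightarrow> G p u \<le> G q v"
    and meas: "(\<lambda>(p, u). G p u) \<in> borel_measurable (restrict_space borel (unit_cube \<times> {0..1}))"
  shows "randomized_p_merging M G"
proof -
  interpret prob_space M by fact
  have "measure M {\<omega>\<in>space M. P \<omega> \<in> unit_cube \<and> U \<omega> \<in> {0..1} \<and> G (P \<omega>) (U \<omega>) \<le> \<alpha>} \<le> \<alpha>"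
    if \<alpha>: "\<alpha> \<in> {0<..<1}" and PU: "(P, U) \<in> pvals_with_uniform M" for \<alpha> P U
  proof -
    have "measure M {\<omega>\<in>space M. P \<omega> \<in> unit_cube \<and> U \<omega> \<in> {0..1} \<and> G (P \<omega>) (U \<omega>) \<le> \<alpha>}
        \<le> measure M {\<omega>\<in>space M. P \<omega> \<in> unit_cube \<and> U \<omega> \<in> {0..1} \<and> F (P \<omega>) (U \<omega>) \<le> \<alpha>}"
    proof (rule finite_measure_mono)
      show "{\<omega>\<in>space M. P \<omega> \<in> unit_cube \<and> U \<omega> \<in> {0..1} \<and> F (P \<omega>) (U \<omega>) \<le> \<alpha>} \<in> sets M"
        using F PU by (intro measurable_pvals_le) (simp_all add: randomized_p_merging_def)
      have "F p u \<le> \<alpha>" if "p \<in> unit_cube" "u \<in> {0..1}" "G p u \<le> \<alpha>" for p u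
        using dom that unfolding dominates_def by (meson order_trans)
      then show "{\<omega>\<in>space M. P \<omega> \<in> unit_cube \<and> U \<omega> \<in> {0..1} \<and> G (P \<omega>) (U \<omega>) \<le> \<alpha>}
        \<subseteq> {\<omega>\<in>space M. P \<omega> \<in> unit_cube \<and> U \<omega> \<in> {0..1} \<and> F (P \<omega>) (U \<omega>) \<le> \<alpha>}"
        by blast
    qed
    also have "\<dots> \<le> \<alpha>" using F \<alpha> PU by (auto simp: randomized_p_merging_def)
    finally show ?thesis .
  qed
  then show ?thesis
    unfolding randomized_p_merging_def using range mono meas by blast
qed

lemma F_UH_dominates_F_UH': "dominates F_UH F_UH'"
  unfolding dominates_def F_UH_eq_threshold F_UH'_eq_threshold
  by (intro ballI threshold_mono score_le_score_pos) simp

lemma F_UH'_dominates_F_H':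
  assumes K: "2 \<le> CARD('k::finite)"
  shows "dominates (F_UH' :: real ^ 'k \<Rightarrow> real \<Rightarrow> real) F_H'"
  unfolding dominates_def
proof (intro ballI)
  fix p :: "real ^ 'k" and u :: real assume p: "p \<in> unit_cube" and "u \<in> {0..1}"
  then have "F_UH' p u \<le> F_UH' p 1"
    unfolding F_UH'_eq_threshold by (intro threshold_mono) auto
  then show "F_UH' p u \<le> F_H' p u" using F_H'_eq_F_UH'[OF K p] by simp
qed

lemma F_UH'_merging:
  assumes M: "prob_space M" and K: "2 \<le> CARD('k::finite)"
  shows "randomized_p_merging M (F_UH' :: real ^ 'k \<Rightarrow> real \<Rightarrow> real)"
proof (rule randomized_p_merging_dominated[OF M F_UH_merging[OF M K] F_UH_dominates_F_UH'])
  show "(\<lambda>(p, u). F_UH' p u) \<in> borel_measurable (restrict_space borel ((unit_cube :: (real ^ 'k) set) \<times> {0..1}))"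
    unfolding F_UH'_eq_threshold by (intro threshold_measurable score_mono[OF K]) auto
qed (auto simp: F_UH'_eq_threshold intro!: threshold_mono score_mono[OF K] threshold_range simp del: atLeastAtMost_iff)

lemma F_H'_merging:
  assumes M: "prob_space M" and K: "2 \<le> CARD('k::finite)"
  shows "randomized_p_merging M (F_H' :: real ^ 'k \<Rightarrow> real \<Rightarrow> real)"
proof (rule randomized_p_merging_dominated[OF M F_UH'_merging[OF M K] F_UH'_dominates_F_H'[OF K]])
  let ?N = "restrict_space borel (unit_cube \<times> {0..1}) :: ((real ^ 'k) \<times> real) measure"
  have F_UH': "(\<lambda>(p, u). F_UH' p u) \<in> borel_measurable ?N"
    using F_UH'_merging[OF M K] by (simp add: randomized_p_merging_def)
  \<comment> \<open>On the cube \<open>F_H'\<close> is \<open>F_UH'\<close> composed with this map,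
    which sets the second coordinate to 1.\<close>
  have "(\<lambda>w. (fst w, 1)) \<in> ?N \<rightarrow>\<^sub>M ?N"
    by (intro measurable_restrict_space3 borel_measurable_continuous_onI continuous_intros) auto
  from measurable_compose[OF this F_UH']
  show "(\<lambda>(p, u). F_H' p u) \<in> borel_measurable ?N"
    by (rule measurable_cong[THEN iffD1, rotated])
      (auto simp: space_restrict_space F_H'_eq_F_UH'[OF K])
  fix p q :: "real ^ 'k" and u v :: real
  assume p: "p \<in> unit_cube"
  show "F_H' p u \<in> {0..1}"
    unfolding F_H'_eq_F_UH'[OF K p] F_UH'_eq_threshold by (rule threshold_range)
  assume "q \<in> unit_cube" "\<And>k. p $ k \<le> q $ k"
  then show "F_H' p u \<le> F_H' q v"
    using p by (simp add: F_H'_eq_F_UH'[OF K])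
      (auto simp: F_UH'_eq_threshold intro!: threshold_mono score_mono[OF K])
qed

section \<open>Strictness of the dominations\<close>

lemma H_vec: "0 \<le> c \<Longrightarrow> H (vec c :: real ^ 'k::finite) = c"
  by (simp add: H_def harmonic_mean_def)

lemma F_UH_strictly_dominates_F_UH':
  assumes K: "2 \<le> CARD('k::finite)"
  shows "strictly_dominates (F_UH :: real ^ 'k \<Rightarrow> real \<Rightarrow> real) F_UH'"
  unfolding strictly_dominates_def
proof (intro conjI bexI)
  show cube: "1 \<in> (unit_cube :: (real ^ 'k) set)" by (simp add: unit_cube_def)
  \<comment> \<open>At \<open>u = 0\<close> every level qualifies for the nonnegative positive-part
    score, so \<open>F_UH\<close> is 0, whereas \<open>F_UH'\<close> is the harmonic mean, here
    1.\<close>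
  show "F_UH (1 :: real ^ 'k) 0 < F_UH' (1 :: real ^ 'k) 0"
    using H_vec[of 1, where 'k = 'k] by (simp add: F_UH_at_zero F_UH'_formula[OF K cube])
qed (auto intro: F_UH_dominates_F_UH')

lemma F_UH'_strictly_dominates_F_H':
  assumes K: "2 \<le> CARD('k::finite)"
  shows "strictly_dominates (F_UH' :: real ^ 'k \<Rightarrow> real \<Rightarrow> real) F_H'"
  unfolding strictly_dominates_def
proof (intro conjI bexI)
  \<comment> \<open>At the all-ones vector both functions would equal 1 by truncation. At
    \<open>1 / 2\<close> the value of \<open>F_UH'\<close> for \<open>u = 0\<close> is
    \<open>1 / 2\<close>, and both \<open>(T + 1) / 2\<close> and the cap 1 exceed it.\<close>
  show cube: "vec (1 / 2) \<in> (unit_cube :: (real ^ 'k) set)" by (simp add: unit_cube_def)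
  show "F_UH' (vec (1 / 2) :: real ^ 'k) 0 < F_H' (vec (1 / 2) :: real ^ 'k) 0"
    using T_pos[OF K] by (simp add: F_UH'_formula[OF K cube] F_H'_def H_vec)
qed (auto intro: F_UH'_dominates_F_H'[OF K])

theorem theorem7p4:
  fixes M :: "'a measure"
  assumes "atomless_prob_space M"
    and "CARD('k::finite) \<ge> 2"
  shows "randomized_p_merging M (F_UH :: real ^ 'k \<Rightarrow> real \<Rightarrow> real) \<and>
    randomized_p_merging M (F_UH' :: real ^ 'k \<Rightarrow> real \<Rightarrow> real) \<and>
    randomized_p_merging M (F_H' :: real ^ 'k \<Rightarrow> real \<Rightarrow> real) \<and>
    strictly_dominates (F_UH :: real ^ 'k \<Rightarrow> real \<Rightarrow> real) F_UH' \<and>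
    strictly_dominates (F_UH' :: real ^ 'k \<Rightarrow> real \<Rightarrow> real) F_H' \<and>
    (\<forall>p\<in>(unit_cube :: (real ^ 'k) set). \<forall>u\<in>{0..1}.
       F_UH' p u = min ((T CARD('k) * u + 1) * H p) 1) \<and>
    (\<forall>p\<in>(unit_cube :: (real ^ 'k) set). \<forall>u\<in>{0<..1}.
       F_UH p u = min (MIN m\<in>{1..CARD('k)}.
         (u * real CARD('k) * T CARD('k) / real m + 1) * H_smallest m p) 1)"
proof (intro conjI ballI)
  have M: "prob_space M" using assms(1) by (simp add: atomless_prob_space_def)
  note K = assms(2)
  show "randomized_p_merging M (F_UH :: real ^ 'k \<Rightarrow> real \<Rightarrow> real)"
    and "randomized_p_merging M (F_UH' :: real ^ 'k \<Rightarrow> real \<Rightarrow> real)"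
    and "randomized_p_merging M (F_H' :: real ^ 'k \<Rightarrow> real \<Rightarrow> real)"
    by (rule F_UH_merging F_UH'_merging F_H'_merging; fact M K)+
  show "strictly_dominates (F_UH :: real ^ 'k \<Rightarrow> real \<Rightarrow> real) F_UH'"
    and "strictly_dominates (F_UH' :: real ^ 'k \<Rightarrow> real \<Rightarrow> real) F_H'"
    by (rule F_UH_strictly_dominates_F_UH'[OF K] F_UH'_strictly_dominates_F_H'[OF K])+
qed (use F_UH'_formula F_UH_formula assms(2) in auto)

end
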